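(* Let $D,d\ge 1$ and let $\theta\mapsto K_m(\theta)\in\mathbb{C}^{D\times D}$, $m=0,\dots,d-1$, be differentiable with $\sum_{m=0}^{d-1}K_m(\theta)^\dagger K_m(\theta)=\mathbb{1}_D$ for all $\theta$. Fix $\theta_0$, write $K_m=K_m(\theta_0)$, $\dot K_m=\partial_\theta K_m(\theta)|_{\theta_0}$, and let $\mathcal{E}(X)=\sum_m K_mXK_m^\dagger$. Suppose $\mathcal{E}$ has a fixed point, i.e. a density matrix $\rho_{ss}$ with $\mathcal{E}(\rho_{ss})=\rho_{ss}$. Define $$\alpha=\sum_m \mathrm{Tr}\big(\dot K_m\rho_{ss}\dot K_m^\dagger\big),\qquad \gamma=\sum_m\mathrm{Tr}\big(K_m\rho_{ss}\dot K_m^\dagger\big),$$ $$\beta_\tau=\mathrm{Tr}\Big[\sum_m \dot K_m\,\mathcal{E}^{\tau}\Big(\sum_n K_n\rho_{ss}\dot K_n^\dagger\Big)K_m^\dagger\Big]\quad(\tau\ge 0).$$ Then for every integer $T\ge 1$ the quantum Fisher information at $\theta_0$ of the $T$-site translation-invariant MPS state $|\Phi_T(\theta)\rangle$ (defined in the context) is $$F_T(\theta_0)=4\Big(T\alpha+2\sum_{\tau=0}^{T-2}(T-\tau-1)\,\mathrm{Re}\,\beta_\tau-T^2|\gamma|^2\Big).$$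
   Context: The isometry $V_\theta:\mathbb{C}^D\to\mathbb{C}^D\otimes\mathbb{C}^d$ is $V_\theta|\psi\rangle=\sum_m K_m(\theta)|\psi\rangle\otimes|m\rangle$; it generates a translation-invariant matrix product state (TI-MPS) with bond dimension $D$ and physical dimension $d$, whose transfer matrix is the channel $\mathcal{E}$. The $T$-site state with left boundary the identity (left fixed point of the transfer matrix) and right boundary $\rho_{ss}$ is realized as follows: let $|\xi\rangle\in\mathbb{C}^D_A\otimes\mathbb{C}^D_S$ be a fixed ($\theta$-independent) purification of $\rho_{ss}$ on an ancilla $A$, and set $|\Phi_T(\theta)\rangle=\sum_{m_1,\dots,m_T}(\mathbb{1}_A\otimes K_{m_T}(\theta)\cdots K_{m_1}(\theta))|\xi\rangle\otimes|m_1\cdots m_T\rangle$. For a pure-state family $|\psi_\theta\rangle$ the quantum Fisher information is $F=4(\langle\dot\psi|\dot\psi\rangle-|\langle\dot\psi|\psi\rangle|^2)$ with $|\dot\psi\rangle=\partial_\theta|\psi_\theta\rangle$. *)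

theory Defs
  imports "HOL-Analysis.Analysis"
begin

text \<open>Matrices in C^{D x D} are complex^'D^'D with 'D a finite type (so D = CARD('D) >= 1);
the Kraus/physical index m ranges over a finite type 'd (d = CARD('d) >= 1).\<close>

definition adj :: "complex^'n^'m \<Rightarrow> complex^'m^'n" where
  "adj A = (\<chi> i j. cnj (A $ j $ i))"

definition is_density :: "complex^'n^'n \<Rightarrow> bool" where
  "is_density \<rho> \<longleftrightarrow> adj \<rho> = \<rho>
     \<and> (\<forall>v::complex^'n. 0 \<le> Re (\<Sum>i\<in>UNIV. cnj (v $ i) * (\<rho> *v v) $ i))
     \<and> trace \<rho> = 1"

text \<open>The channel E(X) = sum_m K_m X K_m^dagger.\<close>
definition chan :: "('d::finite \<Rightarrow> complex^'n^'n) \<Rightarrow> complex^'n^'n \<Rightarrow> complex^'n^'n" where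
  "chan K X = (\<Sum>m\<in>UNIV. K m ** X ** adj (K m))"

text \<open>prodK K [m1,...,mT] = K mT ** ... ** K m1.\<close>
fun prodK :: "('d \<Rightarrow> complex^'n^'n) \<Rightarrow> 'd list \<Rightarrow> complex^'n^'n" where
  "prodK K [] = mat 1"
| "prodK K (m # ms) = prodK K ms ** K m"

text \<open>The T-site state Phi_T(theta): amplitude at index (a, s, [m1,...,mT]), where a is the
ancilla index, s the system (bond) index; xi a s are the components of the purification.\<close>
definition Phi :: "(real \<Rightarrow> 'd::finite \<Rightarrow> complex^'n^'n) \<Rightarrow> ('n \<Rightarrow> 'n \<Rightarrow> complex) \<Rightarrow> nat
                   \<Rightarrow> real \<Rightarrow> ('n \<times> 'n \<times> 'd list) \<Rightarrow> complex" where
  "Phi K \<xi> T \<theta> idx = (case idx of (a, s, ms) \<Rightarrow>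
      if length ms = T then (prodK (K \<theta>) ms *v (\<chi> s'. \<xi> a s')) $ s else 0)"

definition Phi_index :: "nat \<Rightarrow> ('n::finite \<times> 'n \<times> 'd::finite list) set" where
  "Phi_index T = UNIV \<times> UNIV \<times> {ms. length ms = T}"

text \<open>Quantum Fisher information of a pure-state family psi (components indexed by the
finite set I): F = 4(<dpsi|dpsi> - |<dpsi|psi>|^2), dpsi the componentwise theta-derivative.\<close>
definition qfi :: "'i set \<Rightarrow> (real \<Rightarrow> 'i \<Rightarrow> complex) \<Rightarrow> real \<Rightarrow> real" where
  "qfi I \<psi> \<theta>0 =
     (let d\<psi> = (\<lambda>i. vector_derivative (\<lambda>\<theta>. \<psi> \<theta> i) (at \<theta>0)) in
      4 * (Re (\<Sum>i\<in>I. cnj (d\<psi> i) * d\<psi> i) - (cmod (\<Sum>i\<in>I. cnj (d\<psi> i) * \<psi> \<theta>0 i))^2))"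

end

theory Submission
  imports Defs
begin

text \<open>For a word w = m1 ... mn write P_w = K_mn ... K_m1 and dP_w for its derivative, given by
the Leibniz rule. Through the purification, both inner products entering the quantum Fisher
information become sums over words Sigma_w tr(X_w rho Y_w^dagger). Splitting off the first letter
turns such a sum over words of length n + 1 into one over words of length n, with rho replaced by
Sigma_m A_m rho B_m^dagger, and the Kraus condition gives Sigma_w tr(P_w Z P_w^dagger) = tr Z.
With the fixed-point property this yields <dPhi|Phi> = T gamma, while <dPhi|dPhi> obeys a
recursion in T that collects alpha once per site and 2 Re beta_tau once per pair of sites at
distance tau + 1, i.e. T - tau - 1 times.\<close>

lemma matrix_add_rdistrib: "(A + B) ** C = A ** C + B ** C"
  by (simp add: vec_eq_iff matrix_matrix_mult_def distrib_right sum.distrib)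

lemma bounded_bilinear_matrix_matrix_mult:
  "bounded_bilinear
     ((**) :: 'a::{euclidean_space,real_algebra_1}^'n::finite^'m::finite \<Rightarrow> 'a^'p::finite^'n \<Rightarrow> 'a^'p^'m)"
  unfolding bilinear_conv_bounded_bilinear[symmetric] bilinear_def
  by (auto intro!: linearI
      simp: matrix_add_ldistrib matrix_add_rdistrib matrix_scalar_ac scalar_matrix_assoc)

lemmas matrix_mult_sum_left = bounded_bilinear.sum_left[OF bounded_bilinear_matrix_matrix_mult]
lemmas matrix_mult_sum_right = bounded_bilinear.sum_right[OF bounded_bilinear_matrix_matrix_mult]

lemma bounded_linear_matrix_vector_mult_nth:
  "bounded_linear (\<lambda>A::'a::{euclidean_space,real_algebra_1}^'n::finite^'m::finite. (A *v v) $ i)"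
proof -
  have "linear (\<lambda>A::'a^'n^'m. (A *v v) $ i)"
    by (intro linearI)
      (simp_all add: matrix_vector_mult_def scaleR_sum_right distrib_right sum.distrib)
  then show ?thesis
    using linear_conv_bounded_linear by blast
qed

lemma trace_sum: "trace (\<Sum>i\<in>S. f i) = (\<Sum>i\<in>S. trace (f i))"
  unfolding trace_def sum_component by (rule sum.swap)

lemma trace_zero [simp]: "trace 0 = 0"
  by (simp add: trace_def)

lemma adj_adj [simp]: "adj (adj A) = A"
  by (simp add: adj_def vec_eq_iff)

lemma adj_0 [simp]: "adj 0 = 0"
  by (simp add: adj_def vec_eq_iff)

lemma adj_mat_1 [simp]: "adj (mat 1) = mat 1"
  by (simp add: adj_def mat_def vec_eq_iff)

lemma adj_add: "adj (A + B) = adj A + adj B"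
  by (simp add: adj_def vec_eq_iff)

lemma adj_sum: "adj (\<Sum>i\<in>S. f i) = (\<Sum>i\<in>S. adj (f i))"
  by (simp add: adj_def vec_eq_iff)

lemma adj_matrix_mult: "adj (A ** B) = adj B ** adj A"
  by (simp add: adj_def vec_eq_iff matrix_matrix_mult_def mult.commute)

lemma trace_adj: "trace (adj A) = cnj (trace A)"
  by (simp add: adj_def trace_def)

definition mixed_chan ::
  "('d::finite \<Rightarrow> complex^'n^'n) \<Rightarrow> ('d \<Rightarrow> complex^'n^'n) \<Rightarrow> complex^'n^'n \<Rightarrow> complex^'n^'n"
  where "mixed_chan A B Y = (\<Sum>m\<in>UNIV. A m ** Y ** adj (B m))"

lemma chan_eq_mixed_chan: "chan K = mixed_chan K K"
  by (simp add: fun_eq_iff chan_def mixed_chan_def)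

lemma adj_mixed_chan: "adj (mixed_chan A B Y) = mixed_chan B A (adj Y)"
  by (simp add: mixed_chan_def adj_sum adj_matrix_mult matrix_mul_assoc)

lemma adj_chan_funpow: "adj ((chan K ^^ k) Y) = (chan K ^^ k) (adj Y)"
  by (induction k) (simp_all add: chan_eq_mixed_chan adj_mixed_chan)

lemma sum_trace_mixed_chan:
  "(\<Sum>m\<in>UNIV. trace (P ** A m ** Y ** adj (B m) ** Q)) = trace (P ** mixed_chan A B Y ** Q)"
  by (simp add: mixed_chan_def trace_sum matrix_mult_sum_left matrix_mult_sum_right matrix_mul_assoc)

lemma sum_lists_length_Suc:
  fixes f :: "'d::finite list \<Rightarrow> 'a::comm_monoid_add"
  shows "(\<Sum>w | length w = Suc n. f w) = (\<Sum>w | length w = n. \<Sum>m\<in>UNIV. f (m # w))"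
proof -
  have words: "{w. length w = Suc n} = (\<lambda>(w, m). m # w) ` ({w. length w = n} \<times> UNIV)"
    by (auto simp: image_iff length_Suc_conv)
  have "inj_on (\<lambda>(w, m). m # w) ({w::'d list. length w = n} \<times> UNIV)"
    by (auto simp: inj_on_def)
  then show ?thesis
    unfolding words by (simp add: sum.reindex sum.cartesian_product case_prod_unfold)
qed

fun dprodK :: "('d \<Rightarrow> complex^'n^'n) \<Rightarrow> ('d \<Rightarrow> complex^'n^'n) \<Rightarrow> 'd list \<Rightarrow> complex^'n^'n" where
  "dprodK K K' [] = 0"
| "dprodK K K' (m # ms) = prodK K ms ** K' m + dprodK K K' ms ** K m"

lemma has_vector_derivative_prodK:
  fixes K :: "real \<Rightarrow> 'd \<Rightarrow> complex^'n::finite^'n"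
  assumes "\<And>m. ((\<lambda>t. K t m) has_vector_derivative K' m) (at \<theta>)"
  shows "((\<lambda>t. prodK (K t) ms) has_vector_derivative dprodK (K \<theta>) K' ms) (at \<theta>)"
proof (induction ms)
  case Nil
  then show ?case by simp
next
  case (Cons m ms)
  then show ?case
    using bounded_bilinear.has_vector_derivative[OF bounded_bilinear_matrix_matrix_mult _ assms]
    by simp
qed

lemma vector_derivative_prodK_nth:
  fixes K :: "real \<Rightarrow> 'd \<Rightarrow> complex^'n::finite^'n"
  assumes "\<And>m. ((\<lambda>t. K t m) has_vector_derivative K' m) (at \<theta>)"
  shows "vector_derivative (\<lambda>t. (prodK (K t) ms *v v) $ s) (at \<theta>) = (dprodK (K \<theta>) K' ms *v v) $ s"
  by (rule vector_derivative_at bounded_linear.has_vector_derivative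
      bounded_linear_matrix_vector_mult_nth has_vector_derivative_prodK assms)+

definition word_sum ::
  "('d list \<Rightarrow> complex^'n^'n) \<Rightarrow> ('d list \<Rightarrow> complex^'n^'n) \<Rightarrow> nat \<Rightarrow> complex^'n^'n \<Rightarrow> complex"
  where "word_sum P Q n Y = (\<Sum>w | length w = n. trace (P w ** Y ** adj (Q w)))"

lemma cnj_word_sum: "cnj (word_sum P Q n Y) = word_sum Q P n (adj Y)"
  by (simp add: word_sum_def trace_adj[symmetric] adj_matrix_mult matrix_mul_assoc)

lemma word_sum_prodK_prodK_Suc:
  "word_sum (prodK K) (prodK K) (Suc n) Y = word_sum (prodK K) (prodK K) n (chan K Y)"
  unfolding word_sum_def sum_lists_length_Suc
  by (simp add: adj_matrix_mult matrix_mul_assoc sum_trace_mixed_chan chan_eq_mixed_chan)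

lemma word_sum_prodK_dprodK_Suc:
  "word_sum (prodK K) (dprodK K K') (Suc n) Y
     = word_sum (prodK K) (prodK K) n (mixed_chan K K' Y) + word_sum (prodK K) (dprodK K K') n (chan K Y)"
  unfolding word_sum_def sum_lists_length_Suc
  by (simp add: adj_add adj_matrix_mult matrix_add_ldistrib trace_add sum.distrib matrix_mul_assoc
      sum_trace_mixed_chan chan_eq_mixed_chan)

lemma word_sum_dprodK_dprodK_Suc:
  "word_sum (dprodK K K') (dprodK K K') (Suc n) Y
     = word_sum (prodK K) (prodK K) n (mixed_chan K' K' Y)
       + word_sum (prodK K) (dprodK K K') n (mixed_chan K' K Y)
       + word_sum (dprodK K K') (prodK K) n (mixed_chan K K' Y)
       + word_sum (dprodK K K') (dprodK K K') n (chan K Y)"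
  unfolding word_sum_def sum_lists_length_Suc
  by (simp add: adj_add adj_matrix_mult matrix_add_ldistrib matrix_add_rdistrib trace_add sum.distrib
      matrix_mul_assoc sum_trace_mixed_chan chan_eq_mixed_chan)

lemma sum_lessThan_partial_sums:
  fixes f :: "nat \<Rightarrow> 'a::comm_semiring_1"
  shows "(\<Sum>j<n. \<Sum>k<j. f k) = (\<Sum>k<n - 1. of_nat (n - k - 1) * f k)"
proof (induction n)
  case 0
  then show ?case by simp
next
  case (Suc n)
  have "(\<Sum>k<n - 1. of_nat (n - k - 1) * f k) = (\<Sum>k<n. of_nat (n - k - 1) * f k)"
    by (cases n) simp_all
  moreover have "of_nat (n - k) = of_nat (n - k - 1) + (1::'a)" if "k < n" for k
    by (simp add: Suc_diff_Suc[OF that, symmetric] add.commute)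
  ultimately show ?case
    using Suc by (simp add: distrib_right sum.distrib)
qed

context
  fixes K :: "'d::finite \<Rightarrow> complex^'n::finite^'n"
  assumes kraus: "(\<Sum>m\<in>UNIV. adj (K m) ** K m) = mat 1"
begin

lemma trace_chan: "trace (chan K Y) = trace Y"
proof -
  have "trace (chan K Y) = (\<Sum>m\<in>UNIV. trace (adj (K m) ** K m ** Y))"
    unfolding chan_def trace_sum by (metis trace_mul_sym matrix_mul_assoc)
  also have "\<dots> = trace Y"
    by (simp add: trace_sum[symmetric] matrix_mult_sum_left[symmetric] kraus)
  finally show ?thesis .
qed

lemma word_sum_prodK_prodK: "word_sum (prodK K) (prodK K) n Y = trace Y"
proof (induction n arbitrary: Y)
  case 0
  then show ?case by (simp add: word_sum_def)
next
  case (Suc n)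
  then show ?case by (simp add: word_sum_prodK_prodK_Suc trace_chan)
qed

lemma word_sum_prodK_dprodK:
  "word_sum (prodK K) (dprodK K K') n Y = (\<Sum>k<n. trace (mixed_chan K K' ((chan K ^^ k) Y)))"
proof (induction n arbitrary: Y)
  case 0
  then show ?case by (simp add: word_sum_def)
next
  case (Suc n)
  show ?case
    unfolding word_sum_prodK_dprodK_Suc word_sum_prodK_prodK Suc.IH sum.lessThan_Suc_shift
    by (simp add: funpow_Suc_right del: funpow.simps)
qed

lemma word_sum_dprodK_dprodK_fixpoint:
  assumes fixpoint: "chan K \<rho> = \<rho>" and herm: "adj \<rho> = \<rho>"
  shows "word_sum (dprodK K K') (dprodK K K') n \<rho>
           = of_nat n * trace (mixed_chan K' K' \<rho>)
             + (\<Sum>j<n. of_real (2 * Re (word_sum (prodK K) (dprodK K K') j (mixed_chan K' K \<rho>))))"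
proof (induction n)
  case 0
  then show ?case by (simp add: word_sum_def)
next
  case (Suc n)
  have "word_sum (dprodK K K') (prodK K) n (mixed_chan K K' \<rho>)
          = cnj (word_sum (prodK K) (dprodK K K') n (mixed_chan K' K \<rho>))"
    by (simp add: cnj_word_sum adj_mixed_chan herm)
  then show ?case
    using Suc by (simp add: word_sum_dprodK_dprodK_Suc word_sum_prodK_prodK fixpoint
        complex_add_cnj algebra_simps)
qed

lemma Re_word_sum_dprodK_dprodK_fixpoint:
  assumes fixpoint: "chan K \<rho> = \<rho>" and herm: "adj \<rho> = \<rho>"
  shows "Re (word_sum (dprodK K K') (dprodK K K') n \<rho>)
           = real n * Re (trace (mixed_chan K' K' \<rho>))
             + 2 * (\<Sum>\<tau><n - 1. real (n - \<tau> - 1)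
                    * Re (trace (mixed_chan K' K ((chan K ^^ \<tau>) (mixed_chan K K' \<rho>)))))"
proof -
  let ?\<beta> = "\<lambda>\<tau>. Re (trace (mixed_chan K' K ((chan K ^^ \<tau>) (mixed_chan K K' \<rho>))))"
  have "adj (mixed_chan K K' ((chan K ^^ \<tau>) (mixed_chan K' K \<rho>)))
          = mixed_chan K' K ((chan K ^^ \<tau>) (mixed_chan K K' \<rho>))" for \<tau>
    by (simp add: adj_mixed_chan adj_chan_funpow herm)
  then have "Re (trace (mixed_chan K K' ((chan K ^^ \<tau>) (mixed_chan K' K \<rho>)))) = ?\<beta> \<tau>" for \<tau>
    by (metis trace_adj cnj.sel(1))
  then have "Re (word_sum (dprodK K K') (dprodK K K') n \<rho>)
               = real n * Re (trace (mixed_chan K' K' \<rho>)) + (\<Sum>j<n. 2 * (\<Sum>\<tau><j. ?\<beta> \<tau>))"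
    by (simp add: word_sum_dprodK_dprodK_fixpoint[OF fixpoint herm] word_sum_prodK_dprodK)
  also have "\<dots> = real n * Re (trace (mixed_chan K' K' \<rho>))
                   + 2 * (\<Sum>\<tau><n - 1. real (n - \<tau> - 1) * ?\<beta> \<tau>)"
    by (simp add: sum_distrib_left[symmetric] sum_lessThan_partial_sums)
  finally show ?thesis .
qed

end

lemma trace_matrix_mult_adj: "trace (X ** adj Y) = (\<Sum>s\<in>UNIV. \<Sum>a\<in>UNIV. X $ s $ a * cnj (Y $ s $ a))"
  by (simp add: trace_def matrix_matrix_mult_def adj_def)

lemma sum_purification_inner:
  fixes A B :: "complex^'n::finite^'m::finite" and \<xi> :: "'a::finite \<Rightarrow> 'n \<Rightarrow> complex"
  assumes purif: "\<And>s s'. \<rho> $ s $ s' = (\<Sum>a\<in>UNIV. \<xi> a s * cnj (\<xi> a s'))"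
  shows "(\<Sum>a\<in>UNIV. \<Sum>s\<in>UNIV. cnj ((A *v (\<chi> s'. \<xi> a s')) $ s) * (B *v (\<chi> s'. \<xi> a s')) $ s)
           = trace (B ** \<rho> ** adj A)"
proof -
  define \<Xi> :: "complex^'a^'n" where "\<Xi> = (\<chi> s a. \<xi> a s)"
  have \<rho>: "\<rho> = \<Xi> ** adj \<Xi>"
    unfolding vec_eq_iff by (simp add: matrix_matrix_mult_def adj_def \<Xi>_def purif)
  have "(M *v (\<chi> s'. \<xi> a s')) $ s = (M ** \<Xi>) $ s $ a" for M :: "complex^'n^'m" and a s
    by (simp add: matrix_vector_mult_def matrix_matrix_mult_def \<Xi>_def)
  then have "(\<Sum>a\<in>UNIV. \<Sum>s\<in>UNIV. cnj ((A *v (\<chi> s'. \<xi> a s')) $ s) * (B *v (\<chi> s'. \<xi> a s')) $ s)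
               = (\<Sum>s\<in>UNIV. \<Sum>a\<in>UNIV. (B ** \<Xi>) $ s $ a * cnj ((A ** \<Xi>) $ s $ a))"
    by (subst sum.swap) (simp only: mult.commute)
  also have "\<dots> = trace (B ** \<rho> ** adj A)"
    by (simp only: trace_matrix_mult_adj[symmetric] \<rho> adj_matrix_mult matrix_mul_assoc)
  finally show ?thesis .
qed

lemma sum_Phi_index:
  "(\<Sum>i\<in>Phi_index T. g i) = (\<Sum>w | length w = T. \<Sum>a\<in>UNIV. \<Sum>s\<in>UNIV. g (a, s, w))"
proof -
  have "(\<Sum>i\<in>Phi_index T. g i) = (\<Sum>a\<in>UNIV. \<Sum>s\<in>UNIV. \<Sum>w | length w = T. g (a, s, w))"
    by (simp add: Phi_index_def sum.cartesian_product' finite_lists_length_eq)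
  also have "\<dots> = (\<Sum>a\<in>UNIV. \<Sum>w | length w = T. \<Sum>s\<in>UNIV. g (a, s, w))"
    by (intro sum.cong refl sum.swap)
  also have "\<dots> = (\<Sum>w | length w = T. \<Sum>a\<in>UNIV. \<Sum>s\<in>UNIV. g (a, s, w))"
    by (rule sum.swap)
  finally show ?thesis .
qed

lemma qfi_Phi:
  fixes K :: "real \<Rightarrow> 'd::finite \<Rightarrow> complex^'n::finite^'n"
  assumes der: "\<And>m. ((\<lambda>t. K t m) has_vector_derivative K' m) (at \<theta>)"
    and purif: "\<And>s s'. \<rho> $ s $ s' = (\<Sum>a\<in>UNIV. \<xi> a s * cnj (\<xi> a s'))"
  shows "qfi (Phi_index T) (Phi K \<xi> T) \<theta>
           = 4 * (Re (word_sum (dprodK (K \<theta>) K') (dprodK (K \<theta>) K') T \<rho>)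
                  - (cmod (word_sum (prodK (K \<theta>)) (dprodK (K \<theta>) K') T \<rho>))^2)"
proof -
  define d\<Phi> where "d\<Phi> = (\<lambda>i. vector_derivative (\<lambda>t. Phi K \<xi> T t i) (at \<theta>))"
  have d\<Phi>_word: "d\<Phi> (a, s, w) = (dprodK (K \<theta>) K' w *v (\<chi> s'. \<xi> a s')) $ s"
    if "length w = T" for a s w
    using that by (simp add: d\<Phi>_def Phi_def vector_derivative_prodK_nth[OF der])
  have \<Phi>_word: "Phi K \<xi> T \<theta> (a, s, w) = (prodK (K \<theta>) w *v (\<chi> s'. \<xi> a s')) $ s"
    if "length w = T" for a s w
    using that by (simp add: Phi_def)
  have norm: "(\<Sum>i\<in>Phi_index T. cnj (d\<Phi> i) * d\<Phi> i)
          = word_sum (dprodK (K \<theta>) K') (dprodK (K \<theta>) K') T \<rho>"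
    unfolding sum_Phi_index word_sum_def
    by (intro sum.cong refl) (simp add: d\<Phi>_word sum_purification_inner[OF purif])
  have overlap: "(\<Sum>i\<in>Phi_index T. cnj (d\<Phi> i) * Phi K \<xi> T \<theta> i)
                   = word_sum (prodK (K \<theta>)) (dprodK (K \<theta>) K') T \<rho>"
    unfolding sum_Phi_index word_sum_def
    by (intro sum.cong refl) (simp add: d\<Phi>_word \<Phi>_word sum_purification_inner[OF purif])
  show ?thesis
    unfolding qfi_def Let_def d\<Phi>_def[symmetric] norm overlap ..
qed

theorem mainTheorem1:
  fixes K :: "real \<Rightarrow> 'd::finite \<Rightarrow> complex^'D::finite^'D"
    and \<theta>0 :: real
    and \<rho> :: "complex^'D^'D"
    and \<xi> :: "'D \<Rightarrow> 'D \<Rightarrow> complex"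
    and T :: nat
  assumes diff: "\<And>\<theta> m. (\<lambda>t. K t m) differentiable (at \<theta>)"
    and kraus: "\<And>\<theta>. (\<Sum>m\<in>UNIV. adj (K \<theta> m) ** K \<theta> m) = mat 1"
    and dens: "is_density \<rho>"
    and fixed: "chan (K \<theta>0) \<rho> = \<rho>"
    and purif: "\<And>s s'. \<rho> $ s $ s' = (\<Sum>a\<in>UNIV. \<xi> a s * cnj (\<xi> a s'))"
    and T: "T \<ge> 1"
  shows
    "let Km = K \<theta>0;
         Kd = (\<lambda>m. vector_derivative (\<lambda>t. K t m) (at \<theta>0));
         \<alpha> = (\<Sum>m\<in>UNIV. trace (Kd m ** \<rho> ** adj (Kd m)));
         \<gamma> = (\<Sum>m\<in>UNIV. trace (Km m ** \<rho> ** adj (Kd m)));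
         \<beta> = (\<lambda>\<tau>::nat. trace (\<Sum>m\<in>UNIV. Kd m ** (chan Km ^^ \<tau>)
                       (\<Sum>n\<in>UNIV. Km n ** \<rho> ** adj (Kd n)) ** adj (Km m)))
     in complex_of_real (qfi (Phi_index T) (Phi K \<xi> T) \<theta>0)
        = 4 * (of_nat T * \<alpha>
               + 2 * (\<Sum>\<tau><T - 1. of_real (real (T - \<tau> - 1) * Re (\<beta> \<tau>)))
               - of_nat (T^2) * of_real ((cmod \<gamma>)^2))"
proof -
  \<comment> \<open>The identity holds for T = 0 as well.\<close>
  define Kd where "Kd = (\<lambda>m. vector_derivative (\<lambda>t. K t m) (at \<theta>0))"
  have der: "((\<lambda>t. K t m) has_vector_derivative Kd m) (at \<theta>0)" for m
    using diff vector_derivative_works unfolding Kd_def by blast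
  have herm: "adj \<rho> = \<rho>"
    using dens by (simp add: is_density_def)
  have "(chan (K \<theta>0) ^^ k) \<rho> = \<rho>" for k
    by (induction k) (simp_all add: fixed)
  then have overlap: "word_sum (prodK (K \<theta>0)) (dprodK (K \<theta>0) Kd) T \<rho>
                        = of_nat T * trace (mixed_chan (K \<theta>0) Kd \<rho>)"
    by (simp add: word_sum_prodK_dprodK[OF kraus])
  have "cnj (trace (mixed_chan Kd Kd \<rho>)) = trace (mixed_chan Kd Kd \<rho>)"
    by (metis trace_adj adj_mixed_chan herm)
  then have \<alpha>_real: "of_real (Re (trace (mixed_chan Kd Kd \<rho>))) = trace (mixed_chan Kd Kd \<rho>)"
    by (metis Reals_cnj_iff of_real_Re)
  show ?thesis
    unfolding Let_def Kd_def[symmetric] trace_sum[symmetric] mixed_chan_def[symmetric]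
      qfi_Phi[OF der purif] overlap Re_word_sum_dprodK_dprodK_fixpoint[OF kraus fixed herm]
    by (simp add: norm_mult power_mult_distrib \<alpha>_real)
qed

end
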